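(* Let $K$ be a field, let $x_1,\dots,x_n\in K$ and $z_1,\dots,z_n\in K^\times$, and let $S_1,\dots,S_n\subseteq \mathrm{S}_{\mathrm{val}}(K)$ be pairwise disjoint sets of (equivalence classes of) valuations on $K$. Assume: (U) there exists $\pi\in K$ which is a common uniformizer of all $v\in S_1\cup\dots\cup S_n$; (T) each $S_i$ is compact in the Zariski topology on $\mathrm{S}_{\mathrm{val}}(K)$; (I) for any $i,j$ and any valuation $w$ on $K$ with a refinement in $S_i$ and a refinement in $S_j$, we have $w(x_i-x_j)\geq w(z_i)=w(z_j)$. Then there exists $x\in K$ with $$v(x-x_i)>v(z_i)\quad\text{for all } v\in S_i,\ \text{for } i=1,\dots,n.$$
   Context: "Valuation" means Krull valuation (arbitrary ordered abelian value group $\Gamma_v$, written additively; the trivial valuation is allowed), with $v(0)=\infty$. $\mathrm{S}_{\mathrm{val}}(K)$ is the set of equivalence classes of valuations on $K$; $\mathcal{O}_v=\{x\in K: v(x)\ge 0\}$. An element $\pi$ is a uniformizer of $v$ if $v(\pi)$ is the smallest positive element of $\Gamma_v$ (so $\Gamma_v$ is discrete in the sense of having a smallest positive element, i.e. $\Gamma_v$ has $\mathbb{Z}$ as a convex subgroup, with $v(\pi)=1$). A valuation $v$ is a refinement of $w$ (and $w$ a coarsening of $v$) if $\mathcal{O}_v\subseteq\mathcal{O}_w$ (equality allowed). The Zariski topology on $\mathrm{S}_{\mathrm{val}}(K)$ has as subbasis of open sets the sets $\{v\in \mathrm{S}_{\mathrm{val}}(K): v(x)\ge 0\}$, $x\in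 K$. "Compact" means quasi-compact (no Hausdorff condition). *)

theory Defs
  imports
    "HOL-Algebra.Group"
    "HOL-Analysis.Abstract_Topology"
    "HOL-Library.Disjoint_Sets"
begin

text \<open>
  Ordered abelian groups carry an explicit carrier set, because valuations on the same field have
  different value groups.  The group operation is that of HOL-Algebra and hence written
  multiplicatively: \<open>\<otimes>\<close> and \<open>\<one>\<close> are the \<open>+\<close> and \<open>0\<close> of an additively written value group.  The
  order is not reversed: positive means \<open>> \<one>\<close>.
\<close>

record 'g ordered_group = "'g monoid" +
  leq :: "'g \<Rightarrow> 'g \<Rightarrow> bool"

locale ordered_comm_group = comm_group G for G :: "'g ordered_group" (structure) +
  assumes linear: "linear_order_on (carrier G) {(a, b) \<in> carrier G \<times> carrier G. leq G a b}"
    and mult_leq_mono: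
      "\<lbrakk>a \<in> carrier G; b \<in> carrier G; c \<in> carrier G; leq G a b\<rbrakk> \<Longrightarrow> leq G (c \<otimes> a) (c \<otimes> b)"

text \<open>The order and the operation on \<open>\<Gamma> \<union> {\<infinity>}\<close>, where \<open>None\<close> stands for \<open>\<infinity>\<close>.\<close>

fun ext_le :: "'g ordered_group \<Rightarrow> 'g option \<Rightarrow> 'g option \<Rightarrow> bool" where
  "ext_le G a None \<longleftrightarrow> True"
| "ext_le G None (Some b) \<longleftrightarrow> False"
| "ext_le G (Some a) (Some b) \<longleftrightarrow> leq G a b"

definition ext_less :: "'g ordered_group \<Rightarrow> 'g option \<Rightarrow> 'g option \<Rightarrow> bool" where
  "ext_less G a b \<longleftrightarrow> ext_le G a b \<and> a \<noteq> b"

fun ext_mult :: "'g ordered_group \<Rightarrow> 'g option \<Rightarrow> 'g option \<Rightarrow> 'g option" where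
  "ext_mult G (Some a) (Some b) = Some (a \<otimes>\<^bsub>G\<^esub> b)"
| "ext_mult G _ _ = None"

record ('a, 'g) valuation =
  value_group :: "'g ordered_group"
  val :: "'a \<Rightarrow> 'g option"

abbreviation val_le :: "('a, 'g) valuation \<Rightarrow> 'a \<Rightarrow> 'a \<Rightarrow> bool" where
  "val_le v x y \<equiv> ext_le (value_group v) (val v x) (val v y)"

abbreviation val_less :: "('a, 'g) valuation \<Rightarrow> 'a \<Rightarrow> 'a \<Rightarrow> bool" where
  "val_less v x y \<equiv> ext_less (value_group v) (val v x) (val v y)"

text \<open>The value group is exactly the group of values of nonzero elements (\<open>val_range\<close>).\<close>

locale krull_valuation =
  fixes v :: "('a :: field, 'g) valuation"
  assumes value_group: "ordered_comm_group (value_group v)"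
    and val_range: "range (val v) = insert None (Some ` carrier (value_group v))"
    and val_infty_iff: "val v x = None \<longleftrightarrow> x = 0"
    and val_mult: "val v (x * y) = ext_mult (value_group v) (val v x) (val v y)"
    and val_add: "val_le v x (x + y) \<or> val_le v y (x + y)"

definition valuation_ring :: "('a :: field, 'g) valuation \<Rightarrow> 'a set" where
  "valuation_ring v = {x. ext_le (value_group v) (Some \<one>\<^bsub>value_group v\<^esub>) (val v x)}"

definition uniformizer :: "('a :: field, 'g) valuation \<Rightarrow> 'a \<Rightarrow> bool" where
  "uniformizer v p \<longleftrightarrow>
    (let G = value_group v; pos = {c \<in> carrier G. leq G \<one>\<^bsub>G\<^esub> c \<and> c \<noteq> \<one>\<^bsub>G\<^esub>}
     in \<exists>c \<in> pos. val v p = Some c \<and> (\<forall>d \<in> pos. leq G c d))"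

definition refinement :: "('a :: field, 'g) valuation \<Rightarrow> ('a, 'h) valuation \<Rightarrow> bool" where
  "refinement v w \<longleftrightarrow> valuation_ring v \<subseteq> valuation_ring w"

definition equivalent_valuations ::
    "('a :: field, 'g) valuation \<Rightarrow> ('a, 'h) valuation \<Rightarrow> bool" where
  "equivalent_valuations v w \<longleftrightarrow>
    (\<exists>h \<in> iso (value_group v) (value_group w).
      (\<forall>a \<in> carrier (value_group v). \<forall>b \<in> carrier (value_group v).
        leq (value_group w) (h a) (h b) \<longleftrightarrow> leq (value_group v) a b) \<and>
      (\<forall>x. val w x = map_option h (val v x)))"

text \<open>
  HOL cannot collect valuations with value groups in arbitrary types into one set.  It suffices to
  take value groups whose carriers consist of subsets of the field: \<open>val_universe\<close> below shows that
  every valuation, with value group in any type, is equivalent to one of these.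
\<close>

type_synonym 'a kvaluation = "('a, 'a set) valuation"

definition valuation_equiv :: "('a :: field kvaluation \<times> 'a kvaluation) set" where
  "valuation_equiv =
    {(v, w). krull_valuation v \<and> krull_valuation w \<and> equivalent_valuations v w}"

definition S_val :: "'a :: field kvaluation set set" where
  "S_val = {v. krull_valuation v} // valuation_equiv"

definition zariski_topology :: "'a :: field kvaluation set topology" where
  "zariski_topology =
    topology_generated_by (range (\<lambda>x. {c \<in> S_val. \<forall>v \<in> c. x \<in> valuation_ring v}))"

lemma (in krull_valuation) val_in_carrier:
  assumes "val v x = Some a"
  shows "a \<in> carrier (value_group v)"
proof -
  have "Some a \<in> range (val v)" using assms by (metis rangeI)
  then show ?thesis unfolding val_range by auto
qed

lemma equivalent_valuations_sym:
  assumes v: "krull_valuation v" and "equivalent_valuations v w"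
  shows "equivalent_valuations w v"
proof -
  let ?G = "value_group v" and ?H = "value_group w"
  interpret G: ordered_comm_group ?G using v by (rule krull_valuation.value_group)
  obtain h where h: "h \<in> iso ?G ?H"
    and le: "\<And>a b. a \<in> carrier ?G \<Longrightarrow> b \<in> carrier ?G \<Longrightarrow> leq ?H (h a) (h b) \<longleftrightarrow> leq ?G a b"
    and val: "\<And>x. val w x = map_option h (val v x)"
    using assms unfolding equivalent_valuations_def by blast
  define k where "k = inv_into (carrier ?G) h"
  have k: "k \<in> iso ?H ?G" using G.iso_set_sym[OF h] by (simp add: k_def)
  have bij: "bij_betw h (carrier ?G) (carrier ?H)" using h by (simp add: iso_def)
  have kc: "k a \<in> carrier ?G" "h (k a) = a" if "a \<in> carrier ?H" for a
    using that bij by (auto simp: k_def bij_betw_def inv_into_into f_inv_into_f)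
  have "leq ?G (k a) (k b) \<longleftrightarrow> leq ?H a b" if "a \<in> carrier ?H" "b \<in> carrier ?H" for a b
    using le[of "k a" "k b"] kc that by simp
  moreover have "val v x = map_option k (val w x)" for x
  proof (cases "val v x")
    case None then show ?thesis by (simp add: val)
  next
    case (Some a)
    then have "a \<in> carrier ?G"
      by (rule krull_valuation.val_in_carrier[OF v])
    then show ?thesis using Some bij by (simp add: val k_def bij_betw_def inv_into_f_f)
  qed
  ultimately show ?thesis using k unfolding equivalent_valuations_def by blast
qed

lemma equivalent_valuations_trans:
  assumes "equivalent_valuations u v" "equivalent_valuations v w"
  shows "equivalent_valuations u w"
proof -
  obtain h where h: "h \<in> iso (value_group u) (value_group v)"
    and h': "\<forall>a \<in> carrier (value_group u). \<forall>b \<in> carrier (value_group u).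
        leq (value_group v) (h a) (h b) \<longleftrightarrow> leq (value_group u) a b"
      "\<forall>x. val v x = map_option h (val u x)"
    using assms unfolding equivalent_valuations_def by blast
  obtain k where k: "k \<in> iso (value_group v) (value_group w)"
    and k': "\<forall>a \<in> carrier (value_group v). \<forall>b \<in> carrier (value_group v).
        leq (value_group w) (k a) (k b) \<longleftrightarrow> leq (value_group v) a b"
      "\<forall>x. val w x = map_option k (val v x)"
    using assms unfolding equivalent_valuations_def by blast
  have hc: "h a \<in> carrier (value_group v)" if "a \<in> carrier (value_group u)" for a
    using h that by (auto simp: iso_def hom_def)
  have "k \<circ> h \<in> iso (value_group u) (value_group w)"
    using iso_set_trans[OF h k] by (simp add: compose_def comp_def)
  then show ?thesis
    unfolding equivalent_valuations_def using h' k' hc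
    by (intro bexI[of _ "k \<circ> h"]) (auto simp: option.map_comp)
qed

lemma equiv_valuation_equiv: "equiv {v. krull_valuation v} valuation_equiv"
proof (rule equivI)
  show "refl_on {v. krull_valuation v} valuation_equiv"
    unfolding refl_on_def valuation_equiv_def equivalent_valuations_def
    by (auto intro!: bexI[OF _ id_iso] simp: option.map_id)
  show "sym valuation_equiv"
    by (auto simp: sym_def valuation_equiv_def intro: equivalent_valuations_sym)
  show "trans valuation_equiv"
    unfolding trans_def valuation_equiv_def by (blast intro: equivalent_valuations_trans)
qed (auto simp: valuation_equiv_def)

lemma valuation_ring_equivalent:
  assumes v: "krull_valuation v" and w: "krull_valuation w" and "equivalent_valuations v w"
  shows "valuation_ring v = valuation_ring w"
proof -
  let ?G = "value_group v" and ?H = "value_group w"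
  interpret G: ordered_comm_group ?G using v by (rule krull_valuation.value_group)
  interpret H: ordered_comm_group ?H using w by (rule krull_valuation.value_group)
  obtain h where h: "h \<in> iso ?G ?H"
    and le: "\<And>a b. a \<in> carrier ?G \<Longrightarrow> b \<in> carrier ?G \<Longrightarrow> leq ?H (h a) (h b) \<longleftrightarrow> leq ?G a b"
    and val: "\<And>x. val w x = map_option h (val v x)"
    using assms unfolding equivalent_valuations_def by blast
  have one: "h \<one>\<^bsub>?G\<^esub> = \<one>\<^bsub>?H\<^esub>"
    using h by (intro hom_one) (auto simp: iso_def)
  have "x \<in> valuation_ring v \<longleftrightarrow> x \<in> valuation_ring w" for x
  proof (cases "val v x")
    case None then show ?thesis by (simp add: val valuation_ring_def)
  next
    case (Some a)
    then have "a \<in> carrier ?G"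
      by (rule krull_valuation.val_in_carrier[OF v])
    then show ?thesis using Some le[of "\<one>\<^bsub>?G\<^esub>" a] one by (simp add: val valuation_ring_def)
  qed
  then show ?thesis by blast
qed

lemma topspace_zariski [simp]: "topspace zariski_topology = S_val"
proof -
  have "0 \<in> valuation_ring v" if "krull_valuation v" for v :: "'a kvaluation"
    using krull_valuation.val_infty_iff[OF that, of 0] by (simp add: valuation_ring_def)
  moreover have "krull_valuation v" if "c \<in> S_val" "v \<in> c" for c and v :: "'a kvaluation"
    using that by (auto simp: S_val_def quotient_def valuation_equiv_def)
  ultimately show ?thesis by (fastforce simp: zariski_topology_def)
qed

lemma val_universe:
  fixes v :: "('a :: field, 'g) valuation"
  assumes v: "krull_valuation v"
  shows "\<exists>w :: 'a kvaluation. krull_valuation w \<and> equivalent_valuations v w"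
proof -
  interpret V: krull_valuation v by (rule v)
  let ?G = "value_group v"
  interpret G: ordered_comm_group ?G by (rule V.value_group)
  define f where "f a = {x. val v x = Some a}" for a
  define k where "k = inv_into (carrier ?G) f"
  have ex: "\<exists>x. val v x = Some a" if "a \<in> carrier ?G" for a
  proof -
    have "Some a \<in> range (val v)" using that unfolding V.val_range by auto
    then show ?thesis by (auto dest: sym)
  qed
  have car: "a \<in> carrier ?G" if "val v x = Some a" for x a
    using that by (rule V.val_in_carrier)
  have inj: "inj_on f (carrier ?G)"
  proof (rule inj_onI)
    fix a b assume "a \<in> carrier ?G" "b \<in> carrier ?G" "f a = f b"
    moreover obtain x where "val v x = Some a" using ex \<open>a \<in> carrier ?G\<close> by blast
    ultimately show "a = b" by (auto simp: f_def set_eq_iff dest: spec[of _ x])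
  qed
  have kf [simp]: "k (f a) = a" if "a \<in> carrier ?G" for a
    using that inj by (simp add: k_def)
  define H :: "'a set ordered_group" where
    "H = \<lparr>carrier = f ` carrier ?G, monoid.mult = (\<lambda>A B. f (k A \<otimes>\<^bsub>?G\<^esub> k B)), one = f \<one>\<^bsub>?G\<^esub>,
          leq = (\<lambda>A B. leq ?G (k A) (k B))\<rparr>"
  have [simp]: "carrier H = f ` carrier ?G" "a \<otimes>\<^bsub>H\<^esub> b = f (k a \<otimes>\<^bsub>?G\<^esub> k b)"
    "\<one>\<^bsub>H\<^esub> = f \<one>\<^bsub>?G\<^esub>" "leq H a b = leq ?G (k a) (k b)" for a b
    by (simp_all add: H_def)
  define w where "w = \<lparr>value_group = H, val = (\<lambda>x. map_option f (val v x))\<rparr>"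
  have [simp]: "value_group w = H" "val w x = map_option f (val v x)" for x
    by (simp_all add: w_def)
  have ord: "refl_on (carrier ?G) {(a, b) \<in> carrier ?G \<times> carrier ?G. leq ?G a b}"
    "trans {(a, b) \<in> carrier ?G \<times> carrier ?G. leq ?G a b}"
    "antisym {(a, b) \<in> carrier ?G \<times> carrier ?G. leq ?G a b}"
    "total_on (carrier ?G) {(a, b) \<in> carrier ?G \<times> carrier ?G. leq ?G a b}"
    using G.linear by (auto simp: order_on_defs)
  have "comm_group H"
  proof (rule comm_groupI)
    show "x \<otimes>\<^bsub>H\<^esub> y \<otimes>\<^bsub>H\<^esub> z = x \<otimes>\<^bsub>H\<^esub> (y \<otimes>\<^bsub>H\<^esub> z)"
      if "x \<in> carrier H" "y \<in> carrier H" "z \<in> carrier H" for x y z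
      using that by (auto simp del: mem_Collect_eq simp: G.m_assoc)
    show "x \<otimes>\<^bsub>H\<^esub> y = y \<otimes>\<^bsub>H\<^esub> x" if "x \<in> carrier H" "y \<in> carrier H" for x y
      using that by (auto simp: G.m_comm)
    fix x assume "x \<in> carrier H"
    then obtain a where a: "a \<in> carrier ?G" "x = f a" by auto
    then show "\<exists>y\<in>carrier H. y \<otimes>\<^bsub>H\<^esub> x = \<one>\<^bsub>H\<^esub>"
      by (intro bexI[of _ "f (inv\<^bsub>?G\<^esub> a)"]) auto
  qed auto
  moreover have "linear_order_on (carrier H) {(a, b) \<in> carrier H \<times> carrier H. leq H a b}"
    unfolding order_on_defs
  proof (intro conjI)
    show "refl_on (carrier H) {(a, b) \<in> carrier H \<times> carrier H. leq H a b}"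
      using ord(1) by (auto simp: refl_on_def)
    show "trans {(a, b) \<in> carrier H \<times> carrier H. leq H a b}"
      using ord(2) by (auto simp: trans_def)
    show "antisym {(a, b) \<in> carrier H \<times> carrier H. leq H a b}"
    proof (rule antisymI, clarsimp)
      fix a b assume "a \<in> carrier ?G" "b \<in> carrier ?G" "leq ?G a b" "leq ?G b a"
      then have "a = b" using ord(3) unfolding antisym_def by blast
      then show "f a = f b" by simp
    qed
    show "total_on (carrier H) {(a, b) \<in> carrier H \<times> carrier H. leq H a b}"
      using ord(4) by (auto simp: total_on_def)
  qed auto
  ultimately have H: "ordered_comm_group H"
    unfolding ordered_comm_group_def ordered_comm_group_axioms_def
    by (auto simp: G.mult_leq_mono)
  have le: "ext_le H (map_option f a) (map_option f b) \<longleftrightarrow> ext_le ?G a b"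
    if "a \<in> range (val v)" "b \<in> range (val v)" for a b
    using that car by (cases a; cases b) (auto dest!: sym[of _ "val v _"])
  have "krull_valuation w"
  proof (rule krull_valuation.intro)
    show "ordered_comm_group (value_group w)" using H by simp
    show "range (val w) = insert None (Some ` carrier (value_group w))"
    proof -
      have "range (val w) = map_option f ` range (val v)" by auto
      then show ?thesis by (simp add: V.val_range image_image)
    qed
    show "val w x = None \<longleftrightarrow> x = 0" for x by (simp add: V.val_infty_iff)
    show "val w (x * y) = ext_mult (value_group w) (val w x) (val w y)" for x y
      using car by (cases "val v x"; cases "val v y") (auto simp: V.val_mult)
    show "val_le w x (x + y) \<or> val_le w y (x + y)" for x y
      using V.val_add[of x y] by (simp add: le)
  qed
  moreover have "f \<in> iso ?G H"
    using inj by (auto simp: iso_def hom_def bij_betw_def)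
  then have "equivalent_valuations v w"
    unfolding equivalent_valuations_def by (intro bexI[of _ f]) auto
  ultimately show ?thesis by blast
qed

end

(*
  Let p be the common uniformizer. For v in the union of the S_i and all x, both 1 / (1 + p x^2)
  and x / (1 + p x^2) lie in O_v, so every intersection R of such rings is a Pruefer domain: its
  prime localizations are valuation rings and the R-submodules of K form a distributive lattice.
  Hence the Chinese remainder theorem holds for cosets of submodules, and with
  A_i = p z_i B_i, where B_i is the intersection of the O_v for v in S_i, it suffices that
  x_i - x_j lies in A_i + A_j. This is checked at a prime m of R. The localizations of B_i and B_j
  at m are comparable valuation rings; by compactness of S_i and S_j the larger one, say that
  of B_i, is the ring of a common coarsening w of some v in S_i and u in S_j. Hypothesis (I) gives
  w(x_i - x_j) >= w(z_i), and p is a unit for w, since otherwise w = v = u, but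
  S_i and S_j are disjoint.
*)

theory Submission
  imports Defs "HOL-Library.Set_Algebras"
begin

section \<open>Valuations and their rings\<close>

context krull_valuation
begin

sublocale G: ordered_comm_group "value_group v"
  by (rule value_group)

lemma leq_refl: "a \<in> carrier (value_group v) \<Longrightarrow> leq (value_group v) a a"
  using G.linear by (auto simp: order_on_defs refl_on_def)

lemma leq_trans:
  "\<lbrakk>leq (value_group v) a b; leq (value_group v) b c; a \<in> carrier (value_group v);
    b \<in> carrier (value_group v); c \<in> carrier (value_group v)\<rbrakk> \<Longrightarrow> leq (value_group v) a c"
  using G.linear unfolding order_on_defs trans_def by blast

lemma leq_antisym:
  "\<lbrakk>leq (value_group v) a b; leq (value_group v) b a; a \<in> carrier (value_group v);
    b \<in> carrier (value_group v)\<rbrakk> \<Longrightarrow> a = b"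
  using G.linear unfolding order_on_defs antisym_def by blast

lemma leq_total:
  assumes "a \<in> carrier (value_group v)" "b \<in> carrier (value_group v)"
  shows "leq (value_group v) a b \<or> leq (value_group v) b a"
proof (cases "a = b")
  case False
  have "total_on (carrier (value_group v))
      {(a, b) \<in> carrier (value_group v) \<times> carrier (value_group v). leq (value_group v) a b}"
    using G.linear by (simp add: order_on_defs)
  then show ?thesis using assms False unfolding total_on_def by simp
qed (use assms leq_refl in simp)

lemma leq_mult_iff:
  assumes "a \<in> carrier (value_group v)" "b \<in> carrier (value_group v)" "c \<in> carrier (value_group v)"
  shows "leq (value_group v) (c \<otimes>\<^bsub>value_group v\<^esub> a) (c \<otimes>\<^bsub>value_group v\<^esub> b) \<longleftrightarrow>
    leq (value_group v) a b"
proof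
  assume "leq (value_group v) (c \<otimes>\<^bsub>value_group v\<^esub> a) (c \<otimes>\<^bsub>value_group v\<^esub> b)"
  then have "leq (value_group v)
      (inv\<^bsub>value_group v\<^esub> c \<otimes>\<^bsub>value_group v\<^esub> (c \<otimes>\<^bsub>value_group v\<^esub> a))
      (inv\<^bsub>value_group v\<^esub> c \<otimes>\<^bsub>value_group v\<^esub> (c \<otimes>\<^bsub>value_group v\<^esub> b))"
    using assms by (rule_tac G.mult_leq_mono) auto
  then show "leq (value_group v) a b"
    using assms by (simp flip: G.m_assoc)
qed (use assms G.mult_leq_mono in auto)

lemma val_cases:
  obtains "x = 0" "val v x = None"
  | a where "x \<noteq> 0" "val v x = Some a" "a \<in> carrier (value_group v)"
  using val_infty_iff[of x] val_in_carrier by (cases "val v x") auto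

lemma ex_val:
  assumes "a \<in> carrier (value_group v)"
  obtains x where "x \<noteq> 0" "val v x = Some a"
proof -
  have "Some a \<in> range (val v)" using assms val_range by auto
  then obtain x where "val v x = Some a" by (auto dest: sym)
  then show thesis using that val_infty_iff[of x] by auto
qed

lemma val_one: "val v 1 = Some \<one>\<^bsub>value_group v\<^esub>"
proof (cases rule: val_cases[of 1])
  case (2 a)
  then have "a \<otimes>\<^bsub>value_group v\<^esub> a = a" using val_mult[of 1 1] by simp
  then show ?thesis using 2 by (simp add: G.l_cancel_one)
qed simp

lemma val_le_trans:
  assumes "val_le v x y" "val_le v y z"
  shows "val_le v x z"
proof (cases rule: val_cases[of z])
  case (2 c)
  then obtain b where b: "val v y = Some b" "b \<in> carrier (value_group v)"
    using assms(2) by (cases rule: val_cases[of y]) auto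
  then obtain a where a: "val v x = Some a" "a \<in> carrier (value_group v)"
    using assms(1) by (cases rule: val_cases[of x]) auto
  show ?thesis using assms a b 2 leq_trans[of a b c] by simp
qed simp

text \<open>The bridge from values to rings: adding v(x) preserves and reflects the order. It turns
  comparisons of values into membership in the valuation ring, which is the language of the algebra
  below.\<close>

lemma val_le_iff_divide:
  assumes "x \<noteq> 0"
  shows "val_le v x y \<longleftrightarrow> y / x \<in> valuation_ring v"
proof (cases rule: val_cases[of "y / x"])
  case 1
  then show ?thesis using assms val_infty_iff[of 0] by (simp add: valuation_ring_def)
next
  case (2 c)
  obtain a where a: "val v x = Some a" "a \<in> carrier (value_group v)"
    using val_cases assms by metis
  have "val v y = ext_mult (value_group v) (val v x) (val v (y / x))"
    using val_mult[of x "y / x"] assms by simp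
  then have "val v y = Some (a \<otimes>\<^bsub>value_group v\<^esub> c)" using a 2 by simp
  then show ?thesis
    using a 2 leq_mult_iff[of "\<one>\<^bsub>value_group v\<^esub>" c a] by (simp add: valuation_ring_def)
qed

lemma val_eq_iff_divide:
  assumes "x \<noteq> 0" "y \<noteq> 0"
  shows "val v x = val v y \<longleftrightarrow> y / x \<in> valuation_ring v \<and> x / y \<in> valuation_ring v"
proof -
  obtain a where a: "val v x = Some a" "a \<in> carrier (value_group v)"
    using val_cases assms by metis
  obtain b where b: "val v y = Some b" "b \<in> carrier (value_group v)"
    using val_cases assms by metis
  show ?thesis
    unfolding val_le_iff_divide[OF assms(1), symmetric] val_le_iff_divide[OF assms(2), symmetric]
    using a b leq_refl leq_antisym by auto
qed

end

section \<open>Valuation rings as subrings of the field\<close>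

definition unital_subring :: "'a :: field set \<Rightarrow> bool" where
  "unital_subring R \<longleftrightarrow> 1 \<in> R \<and> (\<forall>a\<in>R. \<forall>b\<in>R. a - b \<in> R \<and> a * b \<in> R)"

lemma unital_subringD:
  assumes "unital_subring R"
  shows "0 \<in> R" "1 \<in> R"
    "a \<in> R \<Longrightarrow> b \<in> R \<Longrightarrow> a - b \<in> R"
    "a \<in> R \<Longrightarrow> b \<in> R \<Longrightarrow> a + b \<in> R"
    "a \<in> R \<Longrightarrow> b \<in> R \<Longrightarrow> a * b \<in> R"
    "a \<in> R \<Longrightarrow> - a \<in> R"
proof -
  have *: "1 \<in> R" "\<And>a b. a \<in> R \<Longrightarrow> b \<in> R \<Longrightarrow> a - b \<in> R" "\<And>a b. a \<in> R \<Longrightarrow> b \<in> R \<Longrightarrow> a * b \<in> R"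
    using assms by (auto simp: unital_subring_def)
  show 0: "0 \<in> R" using *(2)[OF *(1) *(1)] by simp
  show m: "- a \<in> R" if "a \<in> R" for a using *(2)[OF 0 that] by simp
  show "a + b \<in> R" if "a \<in> R" "b \<in> R" using *(2)[OF that(1) m[OF that(2)]] by simp
qed (use assms in \<open>auto simp: unital_subring_def\<close>)

text \<open>The valuation rings of a field, described without a valuation. At \<open>x = 0\<close>
  the second clause is harmless, since \<open>inverse 0 = 0\<close> lies in every subring.\<close>

definition total_subring :: "'a :: field set \<Rightarrow> bool" where
  "total_subring V \<longleftrightarrow> unital_subring V \<and> (\<forall>x. x \<in> V \<or> inverse x \<in> V)"

lemma total_subringI:
  assumes "1 \<in> V" "\<And>a b. a \<in> V \<Longrightarrow> b \<in> V \<Longrightarrow> a + b \<in> V"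
    "\<And>a b. a \<in> V \<Longrightarrow> b \<in> V \<Longrightarrow> a * b \<in> V" "\<And>x. x \<noteq> 0 \<Longrightarrow> x \<in> V \<or> inverse x \<in> V"
  shows "total_subring V"
proof -
  \<comment> \<open>-1 is its own inverse, so totality puts it into V; differences then come from
    sums and products.\<close>
  have m1: "-1 \<in> V" using assms(4)[of "-1"] by simp
  have "0 \<in> V" using assms(2)[OF assms(1) m1] by simp
  moreover have "a - b \<in> V" if "a \<in> V" "b \<in> V" for a b
    using assms(2)[OF that(1) assms(3)[OF m1 that(2)]] by simp
  ultimately show ?thesis
    using assms by (metis total_subring_def unital_subring_def)
qed

lemma (in krull_valuation) total_subring_valuation_ring: "total_subring (valuation_ring v)"
proof (rule total_subringI)
  show "1 \<in> valuation_ring v" using val_one leq_refl by (simp add: valuation_ring_def)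
  show "a * b \<in> valuation_ring v" if "a \<in> valuation_ring v" "b \<in> valuation_ring v" for a b
  proof (cases "a = 0")
    case False
    with that have "val_le v 1 a" "val_le v a (a * b)"
      using val_le_iff_divide[of 1 a] val_le_iff_divide[of a "a * b"] by simp_all
    then have "val_le v 1 (a * b)"
      by (rule val_le_trans)
    then show ?thesis using val_le_iff_divide[of 1 "a * b"] by simp
  qed (use that in simp)
  show "a + b \<in> valuation_ring v" if "a \<in> valuation_ring v" "b \<in> valuation_ring v" for a b
  proof -
    have "val_le v 1 a" "val_le v 1 b"
      using that val_le_iff_divide[of 1 a] val_le_iff_divide[of 1 b] by simp_all
    then have "val_le v 1 (a + b)"
      using val_add[of a b] val_le_trans by blast
    then show ?thesis using val_le_iff_divide[of 1 "a + b"] by simp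
  qed
  show "x \<in> valuation_ring v \<or> inverse x \<in> valuation_ring v" if "x \<noteq> 0" for x
  proof -
    obtain a where a: "val v x = Some a" "a \<in> carrier (value_group v)"
      using val_cases \<open>x \<noteq> 0\<close> by metis
    then have "val_le v 1 x \<or> val_le v x 1" using leq_total[of a] val_one by auto
    then show ?thesis
      using val_le_iff_divide[of 1 x] val_le_iff_divide[of x 1] \<open>x \<noteq> 0\<close>
      by (simp add: inverse_eq_divide)
  qed
qed

text \<open>The ring decides which nonzero elements have equal values and which of two values is
  smaller. Hence v(x) \<mapsto> w(x) is a well-defined isomorphism \<open>h\<close> of ordered
  groups, and the choice of a preimage in its definition does not matter.\<close>

lemma equivalent_valuations_if_ring_eq:
  fixes v :: "('a :: field, 'g) valuation" and w :: "('a, 'h) valuation"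
  assumes v: "krull_valuation v" and w: "krull_valuation w"
    and eq: "valuation_ring v = valuation_ring w"
  shows "equivalent_valuations v w"
proof -
  interpret v: krull_valuation v by (rule v)
  interpret w: krull_valuation w by (rule w)
  let ?G = "value_group v" and ?H = "value_group w"
  define h where "h a = the (val w (SOME x. val v x = Some a))" for a
  have val_eq: "val w x = val w y \<longleftrightarrow> val v x = val v y" if "x \<noteq> 0" "y \<noteq> 0" for x y
    using that by (simp add: v.val_eq_iff_divide w.val_eq_iff_divide eq)
  have h: "val w x = Some (h a)" if "val v x = Some a" for x a
  proof -
    have "val v (SOME x. val v x = Some a) = Some a" using that by (rule someI)
    then have "val w x = val w (SOME x. val v x = Some a)"
      using that by (subst val_eq) (auto simp flip: v.val_infty_iff)
    then show ?thesis
      using that by (metis h_def option.collapse option.distinct(1) v.val_infty_iff w.val_infty_iff)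
  qed
  have "h \<in> hom ?G ?H"
  proof (rule homI)
    fix a assume "a \<in> carrier ?G"
    then show "h a \<in> carrier ?H" using v.ex_val h w.val_in_carrier by metis
    fix b assume b: "b \<in> carrier ?G"
    obtain x where x: "val v x = Some a" using v.ex_val[OF \<open>a \<in> _\<close>] by metis
    obtain y where y: "val v y = Some b" using v.ex_val[OF b] by metis
    have "val v (x * y) = Some (a \<otimes>\<^bsub>?G\<^esub> b)" using x y by (simp add: v.val_mult)
    then show "h (a \<otimes>\<^bsub>?G\<^esub> b) = h a \<otimes>\<^bsub>?H\<^esub> h b"
      using h[of "x * y"] h[OF x] h[OF y] by (simp add: w.val_mult)
  qed
  moreover have "bij_betw h (carrier ?G) (carrier ?H)"
  proof (rule bij_betw_imageI)
    show "inj_on h (carrier ?G)"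
    proof (rule inj_onI)
      fix a b assume ab: "a \<in> carrier ?G" "b \<in> carrier ?G" "h a = h b"
      obtain x where x: "x \<noteq> 0" "val v x = Some a" using v.ex_val[OF ab(1)] by metis
      obtain y where y: "y \<noteq> 0" "val v y = Some b" using v.ex_val[OF ab(2)] by metis
      show "a = b" using val_eq[OF x(1) y(1)] h[OF x(2)] h[OF y(2)] x y ab by simp
    qed
    show "h ` carrier ?G = carrier ?H"
    proof
      show "h ` carrier ?G \<subseteq> carrier ?H" using \<open>h \<in> hom ?G ?H\<close> by (auto simp: hom_def)
      show "carrier ?H \<subseteq> h ` carrier ?G"
      proof
        fix b assume "b \<in> carrier ?H"
        then obtain y where y: "y \<noteq> 0" "val w y = Some b" by (rule w.ex_val)
        obtain a where a: "val v y = Some a" "a \<in> carrier ?G" using v.val_cases y(1) by metis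
        then show "b \<in> h ` carrier ?G" using h[OF a(1)] y by auto
      qed
    qed
  qed
  moreover have "leq ?H (h a) (h b) \<longleftrightarrow> leq ?G a b" if ab: "a \<in> carrier ?G" "b \<in> carrier ?G" for a b
  proof -
    obtain x where x: "x \<noteq> 0" "val v x = Some a" using v.ex_val[OF ab(1)] by metis
    obtain y where y: "y \<noteq> 0" "val v y = Some b" using v.ex_val[OF ab(2)] by metis
    show ?thesis
      using v.val_le_iff_divide[OF x(1), of y] w.val_le_iff_divide[OF x(1), of y]
        h[OF x(2)] h[OF y(2)] x y eq by simp
  qed
  moreover have "val w x = map_option h (val v x)" for x
    using h by (cases rule: v.val_cases[of x]) (auto simp: w.val_infty_iff)
  ultimately show ?thesis unfolding equivalent_valuations_def iso_def by blast
qed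

text \<open>The value group is the group of nonzero elements modulo the units of V, ordered by
  divisibility in V; \<open>cls x\<close> is the coset of x. Cosets are subsets of the field, so the
  valuation has the type \<open>'a kvaluation\<close>.\<close>

lemma ex_valuation_of_total_subring:
  fixes V :: "'a :: field set"
  assumes "total_subring V"
  obtains w :: "'a kvaluation" where "krull_valuation w" "valuation_ring w = V"
proof -
  have sub: "unital_subring V" and tot: "\<And>x. x \<in> V \<or> inverse x \<in> V"
    using assms by (auto simp: total_subring_def)
  note V = unital_subringD[OF sub]
  define cls where "cls x = {y. y \<noteq> 0 \<and> y / x \<in> V \<and> x / y \<in> V}" for x
  \<comment> \<open>Product and order are defined on cosets as sets, without chosen representatives;
    \<open>mult\<close> and \<open>leq\<close> below show that they agree with the product and the
    divisibility of any representatives.\<close>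
  define H :: "'a set ordered_group" where
    "H = \<lparr>carrier = cls ` (- {0}), monoid.mult = (\<lambda>A B. {a * b | a b. a \<in> A \<and> b \<in> B}),
      one = cls 1, leq = (\<lambda>A B. \<exists>a\<in>A. \<exists>b\<in>B. b / a \<in> V)\<rparr>"
  have H_simps [simp]: "carrier H = cls ` (- {0})" "\<one>\<^bsub>H\<^esub> = cls 1"
    by (simp_all add: H_def)
  have chain: "c / a \<in> V" if "b / a \<in> V" "c / b \<in> V" "b \<noteq> 0" for a b c
    using V(5)[OF that(1,2)] that(3) by (simp add: field_simps)
  have cls_self: "x \<in> cls x" if "x \<noteq> 0" for x using that V(2) by (simp add: cls_def)
  have cls_eq: "cls x = cls y" if "y / x \<in> V" "x / y \<in> V" "x \<noteq> 0" "y \<noteq> 0" for x y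
    using that chain unfolding cls_def by blast
  have mult [simp]: "cls x \<otimes>\<^bsub>H\<^esub> cls y = cls (x * y)" if nz: "x \<noteq> 0" "y \<noteq> 0" for x y
  proof -
    have "a * b \<in> cls (x * y)" if "a \<in> cls x" "b \<in> cls y" for a b
      using that V(5)[of "a / x" "b / y"] V(5)[of "x / a" "y / b"] by (simp add: cls_def)
    moreover have "c \<in> {a * b | a b. a \<in> cls x \<and> b \<in> cls y}" if "c \<in> cls (x * y)" for c
    proof -
      have "c / x \<in> cls y" using that nz by (simp add: cls_def mult.commute)
      moreover have "c = x * (c / x)" using nz by simp
      ultimately show ?thesis using cls_self[OF nz(1)] by blast
    qed
    ultimately show ?thesis by (auto simp: H_def)
  qed
  have leq [simp]: "leq H (cls x) (cls y) \<longleftrightarrow> y / x \<in> V" if nz: "x \<noteq> 0" "y \<noteq> 0" for x y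
  proof
    assume "leq H (cls x) (cls y)"
    then obtain a b where "a \<in> cls x" "b \<in> cls y" "b / a \<in> V" by (auto simp: H_def)
    then show "y / x \<in> V" unfolding cls_def using chain by blast
  next
    assume "y / x \<in> V"
    then show "leq H (cls x) (cls y)" using cls_self nz by (auto simp: H_def)
  qed
  have "comm_group H"
  proof (rule comm_groupI)
    fix A assume "A \<in> carrier H"
    then obtain x where x: "x \<noteq> 0" "A = cls x" by auto
    then show "\<exists>B\<in>carrier H. B \<otimes>\<^bsub>H\<^esub> A = \<one>\<^bsub>H\<^esub>"
      by (intro bexI[of _ "cls (inverse x)"]) auto
  qed (auto simp: ac_simps)
  moreover have "linear_order_on (carrier H) {(a, b) \<in> carrier H \<times> carrier H. leq H a b}"
  proof -
    have refl: "leq H A A" if A: "A \<in> carrier H" for A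
    proof -
      obtain x where "x \<noteq> 0" "A = cls x" using A unfolding H_simps by blast
      then show ?thesis using V(2) by simp
    qed
    have trans: "leq H A C"
      if A: "A \<in> carrier H" "B \<in> carrier H" "C \<in> carrier H" and le: "leq H A B" "leq H B C" for A B C
    proof -
      obtain x y z where "x \<noteq> 0" "A = cls x" "y \<noteq> 0" "B = cls y" "z \<noteq> 0" "C = cls z"
        using A unfolding H_simps by blast
      then show ?thesis using le chain[of y x z] by simp
    qed
    have antisym: "A = B"
      if A: "A \<in> carrier H" "B \<in> carrier H" and le: "leq H A B" "leq H B A" for A B
    proof -
      obtain x y where "x \<noteq> 0" "A = cls x" "y \<noteq> 0" "B = cls y"
        using A unfolding H_simps by blast
      then show ?thesis using le cls_eq[of y x] by simp
    qed
    have total: "leq H A B \<or> leq H B A" if A: "A \<in> carrier H" "B \<in> carrier H" for A B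
    proof -
      obtain x y where "x \<noteq> 0" "A = cls x" "y \<noteq> 0" "B = cls y"
        using A unfolding H_simps by blast
      then show ?thesis using tot[of "x / y"] by auto
    qed
    show ?thesis
      unfolding order_on_defs refl_on_def trans_def antisym_def total_on_def
      using refl trans antisym total by blast
  qed
  moreover have "leq H (C \<otimes>\<^bsub>H\<^esub> A) (C \<otimes>\<^bsub>H\<^esub> B)"
    if A: "A \<in> carrier H" "B \<in> carrier H" "C \<in> carrier H" and le: "leq H A B" for A B C
  proof -
    obtain x y z where "x \<noteq> 0" "A = cls x" "y \<noteq> 0" "B = cls y" "z \<noteq> 0" "C = cls z"
      using A unfolding H_simps by blast
    then show ?thesis using le by simp
  qed
  ultimately have H: "ordered_comm_group H"
    unfolding ordered_comm_group_def ordered_comm_group_axioms_def by blast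
  define w where "w = \<lparr>value_group = H, val = (\<lambda>x. if x = 0 then None else Some (cls x))\<rparr>"
  have [simp]: "value_group w = H" "val w x = (if x = 0 then None else Some (cls x))" for x
    by (simp_all add: w_def)
  have "krull_valuation w"
  proof (rule krull_valuation.intro)
    show "ordered_comm_group (value_group w)" using H by simp
    show "range (val w) = insert None (Some ` carrier (value_group w))"
      by (auto simp: image_iff)
    show "val_le w x (x + y) \<or> val_le w y (x + y)" for x y
    proof -
      have "(x + y) / x \<in> V \<or> (x + y) / y \<in> V" if "x \<noteq> 0" "y \<noteq> 0"
      proof (cases "y / x \<in> V")
        case True
        then show ?thesis using V(4)[OF V(2), of "y / x"] that by (simp add: add_divide_distrib)
      next
        case False
        then have "x / y \<in> V" using tot[of "y / x"] by simp
        then show ?thesis using V(4)[OF _ V(2), of "x / y"] that by (simp add: add_divide_distrib)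
      qed
      then show ?thesis using V(2) by auto
    qed
  qed auto
  moreover have "valuation_ring w = V"
    using V(1) by (auto simp: valuation_ring_def)
  ultimately show thesis using that by blast
qed

section \<open>Rings with a common uniformizer\<close>

text \<open>What a uniformizer says in terms of the ring: \<open>inverse p \<notin> V\<close> means
  v(p) > 0, and the last clause means that v(x) < 0 forces v(x) <= -v(p), which is the minimality of
  v(p).\<close>

definition uniformized_subring :: "'a :: field \<Rightarrow> 'a set \<Rightarrow> bool" where
  "uniformized_subring p V \<longleftrightarrow>
    unital_subring V \<and> p \<in> V \<and> inverse p \<notin> V \<and> (\<forall>x. x \<notin> V \<longrightarrow> inverse (p * x) \<in> V)"

lemma (in krull_valuation) uniformizer_facts:
  assumes "uniformizer v p"
  shows uniformizer_nonzero: "p \<noteq> 0"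
    and uniformized_subring_valuation_ring: "uniformized_subring p (valuation_ring v)"
proof -
  let ?G = "value_group v"
  obtain c where c: "c \<in> carrier ?G" "leq ?G \<one>\<^bsub>?G\<^esub> c" "c \<noteq> \<one>\<^bsub>?G\<^esub>" "val v p = Some c"
    and min: "\<And>d. d \<in> carrier ?G \<Longrightarrow> leq ?G \<one>\<^bsub>?G\<^esub> d \<Longrightarrow> d \<noteq> \<one>\<^bsub>?G\<^esub> \<Longrightarrow> leq ?G c d"
    using assms unfolding uniformizer_def Let_def by blast
  show p: "p \<noteq> 0" using c val_infty_iff[of p] by auto
  have sub: "unital_subring (valuation_ring v)" and
    tot: "\<And>x. x \<in> valuation_ring v \<or> inverse x \<in> valuation_ring v"
    using total_subring_valuation_ring by (auto simp: total_subring_def)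
  have pV: "p \<in> valuation_ring v" using c by (simp add: valuation_ring_def)
  have "inverse p \<notin> valuation_ring v"
    using val_eq_iff_divide[of 1 p] p pV c val_one by (auto simp: divide_inverse)
  moreover have "inverse (p * x) \<in> valuation_ring v" if x: "x \<notin> valuation_ring v" for x
  proof -
    have x0: "x \<noteq> 0" using x unital_subringD(1)[OF sub] by auto
    then have ix: "inverse x \<in> valuation_ring v" "inverse x \<noteq> 0" using tot x by auto
    obtain d where d: "val v (inverse x) = Some d" "d \<in> carrier ?G"
      using val_cases ix(2) by metis
    have "d \<noteq> \<one>\<^bsub>?G\<^esub>"
      using val_eq_iff_divide[of 1 "inverse x"] x x0 d val_one by (auto simp: divide_inverse)
    then have "val_le v p (inverse x)"
      using min[OF d(2)] ix(1) d c by (simp add: valuation_ring_def)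
    then show ?thesis using val_le_iff_divide[OF p] by (simp add: field_simps)
  qed
  ultimately show "uniformized_subring p (valuation_ring v)"
    using sub pV by (simp add: uniformized_subring_def)
qed

text \<open>Since v(p) > 0, v(y) >= v(p) + v(z) gives v(y) > v(z). This replaces the strict
  inequality of the theorem by membership in a module.\<close>

lemma (in krull_valuation) val_less_if_uniformizer_divides:
  assumes "uniformizer v p" "z \<noteq> 0" "y / (p * z) \<in> valuation_ring v"
  shows "val_less v z y"
proof -
  note p = uniformizer_nonzero[OF assms(1)]
  have "uniformized_subring p (valuation_ring v)"
    using assms(1) by (rule uniformized_subring_valuation_ring)
  then have sub: "unital_subring (valuation_ring v)" and
    pV: "p \<in> valuation_ring v" "inverse p \<notin> valuation_ring v"
    by (auto simp: uniformized_subring_def)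
  have "y / z \<in> valuation_ring v"
    using unital_subringD(5)[OF sub pV(1) assms(3)] p by simp
  then have "val_le v z y" using val_le_iff_divide assms(2) by simp
  moreover have "val v z \<noteq> val v y"
  proof
    assume eq: "val v z = val v y"
    then have y: "y \<noteq> 0" using assms(2) val_infty_iff by metis
    then have "z / y \<in> valuation_ring v" using eq assms(2) val_eq_iff_divide by metis
    then have "inverse p \<in> valuation_ring v"
      using unital_subringD(5)[OF sub assms(3), of "z / y"] y assms(2) by (simp add: field_simps)
    then show False using pV by simp
  qed
  ultimately show ?thesis by (simp add: ext_less_def)
qed

text \<open>p lies in the Jacobson radical. If 1 / (1 + p r) were outside V, the last clause of
  \<open>uniformized_subring\<close> would put (1 + p r) / p = 1/p + r into V, and hence
  1/p.\<close>

lemma uniformized_subring_unit: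
  assumes "uniformized_subring p V" "r \<in> V"
  shows "1 + p * r \<noteq> 0" "1 / (1 + p * r) \<in> V"
proof -
  have sub: "unital_subring V" and p: "p \<in> V" "inverse p \<notin> V"
    and out: "\<And>x. x \<notin> V \<Longrightarrow> inverse (p * x) \<in> V"
    using assms by (auto simp: uniformized_subring_def)
  note V = unital_subringD[OF sub]
  have p0: "p \<noteq> 0" using p V(1) by auto
  show nz: "1 + p * r \<noteq> 0"
  proof
    assume "1 + p * r = 0"
    then have "inverse p = - r" using p0 by (simp add: field_simps eq_neg_iff_add_eq_0)
    then show False using V(6)[OF assms(2)] p(2) by simp
  qed
  show "1 / (1 + p * r) \<in> V"
  proof (rule ccontr)
    assume "1 / (1 + p * r) \<notin> V"
    then have "inverse (p * (1 / (1 + p * r))) \<in> V" by (rule out)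
    moreover have "inverse (p * (1 / (1 + p * r))) = inverse p + r"
      using p0 nz by (simp add: field_simps)
    ultimately show False using V(3)[OF _ assms(2)] p(2) by fastforce
  qed
qed

text \<open>
  In the next two lemmas an argument outside the ring is replaced by \<open>y = 1 / (p * x)\<close>, which lies
  in it.
\<close>

lemma uniformized_subring_pole:
  assumes "uniformized_subring p V"
  shows "1 + p * x\<^sup>2 \<noteq> 0" "1 / (1 + p * x\<^sup>2) \<in> V" "x / (1 + p * x\<^sup>2) \<in> V"
proof -
  have sub: "unital_subring V" and p: "p \<in> V" "inverse p \<notin> V"
    and out: "\<And>x. x \<notin> V \<Longrightarrow> inverse (p * x) \<in> V"
    using assms by (auto simp: uniformized_subring_def)
  note V = unital_subringD[OF sub]
  note unit = uniformized_subring_unit[OF assms]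
  have "1 + p * x\<^sup>2 \<noteq> 0 \<and> 1 / (1 + p * x\<^sup>2) \<in> V \<and> x / (1 + p * x\<^sup>2) \<in> V"
  proof (cases "x \<in> V")
    case True
    have "x\<^sup>2 \<in> V" using V(5) True by (simp add: power2_eq_square)
    then show ?thesis using unit V(5)[OF True, of "1 / (1 + p * x\<^sup>2)"] by simp
  next
    case False
    define y where "y = inverse (p * x)"
    have y: "y \<in> V" using out False by (simp add: y_def)
    have p0: "p \<noteq> 0" and x0: "x \<noteq> 0" using p False V(1) by auto
    have y0: "y \<noteq> 0" and x: "x = inverse (p * y)" using p0 x0 by (simp_all add: y_def)
    have y2: "y\<^sup>2 \<in> V" using V(5) y by (simp add: power2_eq_square)
    \<comment> \<open>In terms of y the two fractions become p y^2 / (1 + p y^2) and y / (1 + p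
      y^2), whose denominator is a unit.\<close>
    have "1 + p * x\<^sup>2 = (1 + p * y\<^sup>2) / (p * y\<^sup>2)"
      using p0 y0 by (simp add: x field_simps power2_eq_square)
    moreover have "p * y\<^sup>2 \<in> V" using V(5) p y2 by blast
    moreover have "x * (p * y\<^sup>2) = y" using p0 y0 by (simp add: x field_simps power2_eq_square)
    ultimately show ?thesis
      using p0 y0 unit[OF y2]
        V(5)[of "p * y\<^sup>2" "1 / (1 + p * y\<^sup>2)"] V(5)[of y "1 / (1 + p * y\<^sup>2)"] y by simp
  qed
  then show "1 + p * x\<^sup>2 \<noteq> 0" "1 / (1 + p * x\<^sup>2) \<in> V" "x / (1 + p * x\<^sup>2) \<in> V" by auto
qed

text \<open>The quotient \<open>(1 + p * q^3) / (1 + p * q\<^sup>2)\<close> has value exactly \<open>min 0 (v q)\<close>.\<close>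

lemma uniformized_subring_min:
  assumes "uniformized_subring p V"
  shows "1 + p * q ^ 3 \<noteq> 0"
    "(1 + p * q\<^sup>2) / (1 + p * q ^ 3) \<in> V" "q * ((1 + p * q\<^sup>2) / (1 + p * q ^ 3)) \<in> V"
proof -
  have sub: "unital_subring V" and p: "p \<in> V" "inverse p \<notin> V"
    and out: "\<And>x. x \<notin> V \<Longrightarrow> inverse (p * x) \<in> V"
    using assms by (auto simp: uniformized_subring_def)
  note V = unital_subringD[OF sub]
  have pow: "y ^ k \<in> V" if "y \<in> V" for y and k :: nat
    using that V by (induction k) auto
  note unit = uniformized_subring_unit[OF assms]
  have num: "(1 + p * y\<^sup>2) * (1 / (1 + p * r)) \<in> V" if "y \<in> V" "r \<in> V" for y r
    using V(5)[OF V(4)[OF V(2) V(5)[OF p(1) pow[OF that(1)]]] unit(2)[OF that(2)]] .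
  have "1 + p * q ^ 3 \<noteq> 0 \<and> (1 + p * q\<^sup>2) / (1 + p * q ^ 3) \<in> V \<and>
    q * ((1 + p * q\<^sup>2) / (1 + p * q ^ 3)) \<in> V"
  proof (cases "q \<in> V")
    case True
    then have "(1 + p * q\<^sup>2) / (1 + p * q ^ 3) \<in> V" using num[OF True pow[OF True, of 3]] by simp
    then show ?thesis using unit(1)[OF pow[OF True]] V(5)[OF True] by blast
  next
    case False
    define y where "y = inverse (p * q)"
    have y: "y \<in> V" using out False by (simp add: y_def)
    have p0: "p \<noteq> 0" and q0: "q \<noteq> 0" using p False V(1) by auto
    have y0: "y \<noteq> 0" and q: "q = 1 / (p * y)" using p0 q0 by (simp_all add: y_def field_simps)
    have r: "p * y ^ 3 \<in> V" using V(5)[OF p(1) pow[OF y]] .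
    have eq3: "1 + p * q ^ 3 = (1 + p * (p * y ^ 3)) / (p * (p * y ^ 3))"
      using p0 y0 by (simp add: q field_simps power2_eq_square power3_eq_cube)
    have eq2: "1 + p * q\<^sup>2 = (1 + p * y\<^sup>2) / (p * y\<^sup>2)"
      using p0 y0 by (simp add: q field_simps power2_eq_square)
    \<comment> \<open>\<open>g\<close> is a quotient of two units. The fraction of the lemma equals
      p y g, and multiplying it by q = 1 / (p y) leaves g.\<close>
    define g where "g = (1 + p * y\<^sup>2) * (1 / (1 + p * (p * y ^ 3)))"
    have g: "g \<in> V" using num[OF y r] by (simp add: g_def)
    have "(1 + p * q\<^sup>2) / (1 + p * q ^ 3) = p * y * g"
      unfolding eq2 eq3 g_def using p0 y0 by (simp add: power2_eq_square power3_eq_cube)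
    moreover have "q * (p * y * g) = g" using p0 y0 by (simp add: q)
    moreover have "p * y * g \<in> V" using V(5) p y g by blast
    moreover have "1 + p * q ^ 3 \<noteq> 0" using p0 y0 unit(1)[OF r] eq3 by simp
    ultimately show ?thesis using g by metis
  qed
  then show "1 + p * q ^ 3 \<noteq> 0"
    "(1 + p * q\<^sup>2) / (1 + p * q ^ 3) \<in> V" "q * ((1 + p * q\<^sup>2) / (1 + p * q ^ 3)) \<in> V" by auto
qed

text \<open>An element x of V outside W would give 1 / (p x) in W, hence in V, and multiplying by x
  would put 1/p into V. So p becomes a unit in every proper overring of W.\<close>

lemma uniformized_subring_maximal:
  assumes "uniformized_subring p W" "unital_subring V" "W \<subseteq> V" "inverse p \<notin> V"
  shows "V = W"
proof (rule ccontr)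
  assume "V \<noteq> W"
  then obtain x where x: "x \<in> V" "x \<notin> W" using assms(3) by blast
  then have "inverse (p * x) \<in> V" "x \<noteq> 0"
    using assms(1,3) unital_subringD(1)[of W] by (auto simp: uniformized_subring_def)
  then have "inverse p \<in> V"
    using unital_subringD(5)[OF assms(2), of "inverse (p * x)" x] x(1) by (simp add: mult.assoc)
  then show False using assms(4) by simp
qed

text \<open>These conditions pass to intersections, which totality does not. They serve as an
  explicit form of the Pruefer property.\<close>

locale pole_ring =
  fixes p :: "'a :: field" and R :: "'a set"
  assumes subring: "unital_subring R" and p_in: "p \<in> R"
    and nz: "1 + p * x\<^sup>2 \<noteq> 0"
    and pole0: "1 / (1 + p * x\<^sup>2) \<in> R" and pole1: "x / (1 + p * x\<^sup>2) \<in> R"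

lemma pole_ring_Inter:
  assumes "F \<noteq> {}" "\<And>V. V \<in> F \<Longrightarrow> uniformized_subring p V"
  shows "pole_ring p (\<Inter>F)"
proof
  show "unital_subring (\<Inter>F)" "p \<in> \<Inter>F"
    using assms(2) unfolding uniformized_subring_def unital_subring_def by blast+
  show "1 / (1 + p * x\<^sup>2) \<in> \<Inter>F" "x / (1 + p * x\<^sup>2) \<in> \<Inter>F" for x
    using uniformized_subring_pole assms(2) by blast+
  show "1 + p * x\<^sup>2 \<noteq> 0" for x
    using uniformized_subring_pole(1) assms by blast
qed

context pole_ring
begin

lemmas R = unital_subringD[OF subring]

lemma pole2: "p * x / (1 + p * x\<^sup>2) \<in> R" "p * x\<^sup>2 / (1 + p * x\<^sup>2) \<in> R"
proof -
  show "p * x / (1 + p * x\<^sup>2) \<in> R" using R(5)[OF p_in pole1[of x]] by simp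
  have "p * x\<^sup>2 / (1 + p * x\<^sup>2) = 1 - 1 / (1 + p * x\<^sup>2)" using nz[of x] by (simp add: field_simps)
  then show "p * x\<^sup>2 / (1 + p * x\<^sup>2) \<in> R" using R(3)[OF R(2) pole0[of x]] by simp
qed

text \<open>A partition f + g = 1 in R such that x f lies in R and, for nonzero x, also g / x. The
  distributive law and the totality of localizations both rest on it.\<close>

lemma pole_sum: "1 / (1 + p * x\<^sup>2) + p * x\<^sup>2 / (1 + p * x\<^sup>2) = 1"
  using nz[of x] by (simp flip: add_divide_distrib)

section \<open>The lattice of R-submodules and the Chinese remainder theorem\<close>

definition submod :: "'a set \<Rightarrow> bool" where
  "submod A \<longleftrightarrow> 0 \<in> A \<and> (\<forall>a\<in>A. \<forall>b\<in>A. a + b \<in> A) \<and> (\<forall>r\<in>R. \<forall>a\<in>A. r * a \<in> A)"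

lemma submodD:
  assumes "submod A"
  shows "0 \<in> A" "a \<in> A \<Longrightarrow> b \<in> A \<Longrightarrow> a + b \<in> A" "r \<in> R \<Longrightarrow> a \<in> A \<Longrightarrow> r * a \<in> A"
    "a \<in> A \<Longrightarrow> - a \<in> A" "a \<in> A \<Longrightarrow> b \<in> A \<Longrightarrow> a - b \<in> A"
proof -
  show *: "0 \<in> A" "\<And>a b. a \<in> A \<Longrightarrow> b \<in> A \<Longrightarrow> a + b \<in> A"
    "\<And>r a. r \<in> R \<Longrightarrow> a \<in> A \<Longrightarrow> r * a \<in> A"
    using assms by (auto simp: submod_def)
  show m: "- a \<in> A" if "a \<in> A" for a
    using *(3)[OF R(6)[OF R(2)] that] by simp
  show "a - b \<in> A" if "a \<in> A" "b \<in> A" using *(2)[OF that(1) m[OF that(2)]] by simp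
qed

lemma submod_plus:
  assumes "submod A" "submod B"
  shows "submod (A + B)"
  unfolding submod_def
proof (intro conjI ballI)
  note A = submodD[OF assms(1)] and B = submodD[OF assms(2)]
  show "0 \<in> A + B" using set_plus_intro[OF A(1) B(1)] by simp
  show "c + d \<in> A + B" if cd: "c \<in> A + B" "d \<in> A + B" for c d
  proof -
    obtain a b where ab: "a \<in> A" "b \<in> B" "c = a + b" using cd(1) by (rule set_plus_elim)
    obtain a' b' where ab': "a' \<in> A" "b' \<in> B" "d = a' + b'" using cd(2) by (rule set_plus_elim)
    have "c + d = (a + a') + (b + b')" using ab ab' by simp
    then show ?thesis using ab ab' A(2) B(2) by (metis set_plus_intro)
  qed
  show "r * c \<in> A + B" if "r \<in> R" and c: "c \<in> A + B" for r c
  proof -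
    obtain a b where ab: "a \<in> A" "b \<in> B" "c = a + b" using c by (rule set_plus_elim)
    then show ?thesis using A(3)[OF \<open>r \<in> R\<close> ab(1)] B(3)[OF \<open>r \<in> R\<close> ab(2)]
      by (auto simp: distrib_left intro: set_plus_intro)
  qed
qed

lemma submod_INT: "(\<And>i. i \<in> F \<Longrightarrow> submod (A i)) \<Longrightarrow> submod (\<Inter>i\<in>F. A i)"
  by (auto simp: submod_def)

text \<open>Write d = a + b = a' + c and take the partition f + g = 1 belonging to t = b / c. In d =
  f d + g d, use the first expression in f d and the second in g d. Then f b = (t f) c lies in both
  B and C, and so does g c = (g / t) b, read as p t / (1 + p t^2) times b. The case c = 0, where t
  is meaningless, is trivial.\<close>

lemma submod_distrib:
  assumes "submod A" "submod B" "submod C" and "d \<in> A + B" "d \<in> A + C"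
  shows "d \<in> A + (B \<inter> C)"
proof -
  note A = submodD[OF assms(1)] and B = submodD[OF assms(2)] and C = submodD[OF assms(3)]
  obtain a b where ab: "a \<in> A" "b \<in> B" "d = a + b" using assms(4) by (rule set_plus_elim)
  obtain a' c where ac: "a' \<in> A" "c \<in> C" "d = a' + c" using assms(5) by (rule set_plus_elim)
  show ?thesis
  proof (cases "c = 0")
    case True
    then show ?thesis using ac B(1) C(1) set_plus_intro[of d A 0 "B \<inter> C"] by simp
  next
    case False
    define t where "t = b / c"
    define f where "f = 1 / (1 + p * t\<^sup>2)"
    define g where "g = p * t\<^sup>2 / (1 + p * t\<^sup>2)"
    have fg: "f \<in> R" "g \<in> R" "f + g = 1" using pole0 pole2 pole_sum by (auto simp: f_def g_def)
    have "b * f = (t / (1 + p * t\<^sup>2)) * c" using False by (simp add: t_def f_def)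
    then have "b * f \<in> C" using C(3)[OF pole1 ac(2)] by simp
    moreover have "c * g = (p * t / (1 + p * t\<^sup>2)) * b"
      using False by (simp add: t_def g_def power2_eq_square)
    then have "c * g \<in> B" using B(3)[OF pole2(1) ab(2)] by simp
    ultimately have "b * f + c * g \<in> B \<inter> C"
      using fg B(2) B(3)[OF fg(1) ab(2)] C(2) C(3)[OF fg(2) ac(2)] by (simp add: mult.commute)
    moreover have "f * a + g * a' \<in> A" using fg A ab ac by blast
    moreover have "d = d * f + d * g" using fg(3) by (simp flip: distrib_left)
    then have "d = (a + b) * f + (a' + c) * g" using ab(3) ac(3) by metis
    then have "d = (f * a + g * a') + (b * f + c * g)" by (simp add: algebra_simps)
    ultimately show ?thesis using set_plus_intro by metis
  qed
qed

lemma submod_distrib_INT: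
  assumes "finite F" "submod A" "\<And>i. i \<in> F \<Longrightarrow> submod (B i)" "\<And>i. i \<in> F \<Longrightarrow> d \<in> A + B i"
  shows "d \<in> A + (\<Inter>i\<in>F. B i)"
  using assms(1,3,4)
proof (induction F)
  case empty
  \<comment> \<open>The empty intersection is the whole field, so d = 0 + d is the required
    sum.\<close>
  then show ?case using set_plus_intro[OF submodD(1)[OF assms(2)], of d UNIV] by simp
next
  case (insert k F)
  then have "d \<in> A + (B k \<inter> (\<Inter>i\<in>F. B i))"
    by (intro submod_distrib assms(2) submod_INT) auto
  then show ?case by simp
qed

text \<open>Distributivity makes pairwise conditions suffice. If y solves the congruences for F,
  then x_k - y lies in each A_k + A_i, hence in A_k plus the intersection of the A_i. The second
  summand b corrects y to y + b without disturbing the congruences for F.\<close>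

lemma chinese_remainder:
  assumes "finite F" "\<And>i. i \<in> F \<Longrightarrow> submod (A i)"
    and "\<And>i j. i \<in> F \<Longrightarrow> j \<in> F \<Longrightarrow> x i - x j \<in> A i + A j"
  shows "\<exists>y. \<forall>i\<in>F. y - x i \<in> A i"
  using assms
proof (induction F)
  case (insert k F)
  have "\<exists>y. \<forall>i\<in>F. y - x i \<in> A i"
    by (rule insert.IH) (simp_all add: insert.prems)
  then obtain y where y: "\<And>i. i \<in> F \<Longrightarrow> y - x i \<in> A i" by blast
  have "x k - y \<in> A k + A i" if "i \<in> F" for i
  proof -
    obtain a b where ab: "a \<in> A k" "b \<in> A i" "x k - x i = a + b"
      using insert.prems(2)[of k i] \<open>i \<in> F\<close> by (metis insertCI set_plus_elim)
    have "b - (y - x i) \<in> A i"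
      using submodD(5)[OF insert.prems(1) ab(2) y] that by simp
    moreover have "x k - y = a + (b - (y - x i))" using ab(3) by (simp add: algebra_simps)
    ultimately show ?thesis using ab(1) by (metis set_plus_intro)
  qed
  then have "x k - y \<in> A k + (\<Inter>i\<in>F. A i)"
    using insert by (intro submod_distrib_INT) auto
  then obtain a b where ab: "a \<in> A k" "b \<in> (\<Inter>i\<in>F. A i)" "x k - y = a + b"
    by (rule set_plus_elim)
  have "(y + b) - x i \<in> A i" if "i \<in> insert k F" for i
  proof (cases "i = k")
    case True
    have "(y + b) - x k = - a" using ab(3) by (simp add: algebra_simps)
    then show ?thesis using submodD(4)[OF insert.prems(1) ab(1)] True by simp
  next
    case False
    then have "i \<in> F" using that by simp
    then have "(y - x i) + b \<in> A i" using ab(2) y submodD(2)[OF insert.prems(1)[of i]] by auto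
    then show ?thesis by (simp add: algebra_simps)
  qed
  then show ?case by blast
qed simp

section \<open>Prime ideals and localization\<close>

definition prime_submod :: "'a set \<Rightarrow> bool" where
  "prime_submod m \<longleftrightarrow>
    submod m \<and> 1 \<notin> m \<and> (\<forall>a\<in>R. \<forall>b\<in>R. a * b \<in> m \<longrightarrow> a \<in> m \<or> b \<in> m)"

text \<open>Zorn's lemma gives a maximal proper ideal above J; maximality makes it comaximal with
  every element of R outside it, and this yields primality.\<close>

lemma ex_prime_submod:
  assumes J: "submod J" "J \<subseteq> R" "1 \<notin> J"
  obtains m where "prime_submod m" "J \<subseteq> m"
proof -
  define X where "X = {I. submod I \<and> J \<subseteq> I \<and> I \<subseteq> R \<and> 1 \<notin> I}"
  have "\<exists>m\<in>X. \<forall>I\<in>X. m \<subseteq> I \<longrightarrow> I = m"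
  proof (rule subset_Zorn_nonempty)
    show "X \<noteq> {}" using J by (auto simp: X_def)
    fix C assume C: "C \<noteq> {}" "subset.chain X C"
    then have CX: "\<And>I. I \<in> C \<Longrightarrow> I \<in> X" by (auto simp: subset.chain_def)
    have "a + b \<in> \<Union>C" if ab: "a \<in> \<Union>C" "b \<in> \<Union>C" for a b
    proof -
      obtain I I' where I: "I \<in> C" "a \<in> I" "I' \<in> C" "b \<in> I'" using ab by blast
      have "I \<subseteq> I' \<or> I' \<subseteq> I" using C(2) I by (auto simp: subset.chain_def)
      then obtain K where "K \<in> C" "a \<in> K" "b \<in> K" using I by blast
      then show ?thesis using CX[of K] by (auto simp: X_def submod_def)
    qed
    moreover have "0 \<in> \<Union>C" using C(1) CX by (auto simp: X_def submod_def)
    moreover have "r * a \<in> \<Union>C" if "r \<in> R" "a \<in> \<Union>C" for r a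
      using that CX unfolding X_def submod_def by blast
    ultimately have "submod (\<Union>C)" by (simp add: submod_def)
    then show "\<Union>C \<in> X" using C(1) CX by (auto simp: X_def)
  qed
  then obtain m where "m \<in> X" and max: "\<And>I. I \<in> X \<Longrightarrow> m \<subseteq> I \<Longrightarrow> I = m" by blast
  then have m: "submod m" "J \<subseteq> m" "m \<subseteq> R" "1 \<notin> m" by (auto simp: X_def)
  note M = submodD[OF m(1)]
  have comax: "\<exists>c\<in>m. \<exists>r\<in>R. 1 = c + r * a" if a: "a \<in> R" "a \<notin> m" for a
  proof (rule ccontr)
    assume none: "\<not> ?thesis"
    define K where "K = m + (\<lambda>r. r * a) ` R"
    have "submod ((\<lambda>r. r * a) ` R)"
      unfolding submod_def
    proof (intro conjI ballI)
      show "0 \<in> (\<lambda>r. r * a) ` R" using R(1) by (auto simp: image_iff intro: bexI[of _ 0])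
      show "b + c \<in> (\<lambda>r. r * a) ` R" if "b \<in> (\<lambda>r. r * a) ` R" "c \<in> (\<lambda>r. r * a) ` R" for b c
        using that R(4) by (auto simp flip: distrib_right)
      show "s * b \<in> (\<lambda>r. r * a) ` R" if "s \<in> R" "b \<in> (\<lambda>r. r * a) ` R" for s b
        using that R(5) by (auto simp flip: mult.assoc)
    qed
    then have "submod K" unfolding K_def by (rule submod_plus[OF m(1)])
    moreover have mK: "m \<subseteq> K"
    proof
      fix c assume "c \<in> m"
      then show "c \<in> K"
        unfolding K_def using set_plus_intro[of c m 0 "(\<lambda>r. r * a) ` R"] R(1) by force
    qed
    moreover have "K \<subseteq> R" unfolding K_def using m(3) R a(1) by (auto elim!: set_plus_elim)
    moreover have "1 \<notin> K" unfolding K_def using none by (auto elim!: set_plus_elim)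
    ultimately have "K = m" using m(2) by (intro max) (auto simp: X_def)
    moreover have "a \<in> K"
      unfolding K_def using set_plus_intro[OF M(1), of a "(\<lambda>r. r * a) ` R"] R(2) by force
    ultimately show False using a by simp
  qed
  have "a \<in> m \<or> b \<in> m" if ab: "a \<in> R" "b \<in> R" "a * b \<in> m" for a b
  proof (rule ccontr)
    assume "\<not> ?thesis"
    then obtain c r d s where *: "c \<in> m" "r \<in> R" "1 = c + r * a" "d \<in> m" "s \<in> R" "1 = d + s * b"
      using comax ab by metis
    \<comment> \<open>Each term of the expanded product has a factor \<open>c\<close>,
      \<open>d\<close> or \<open>a * b\<close>, all in \<open>m\<close>, so 1 would lie in
      \<open>m\<close>.\<close>
    have "1 = (c + r * a) * (d + s * b)" using *(3,6) by simp
    also have "\<dots> = (d + s * b) * c + (r * a) * d + (r * s) * (a * b)" by (simp add: algebra_simps)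
    also have "\<dots> = c + (r * a) * d + (r * s) * (a * b)" using *(6) by simp
    also have "\<dots> \<in> m"
      using M(2)[OF M(2)[OF *(1) M(3)[OF R(5)[OF *(2) ab(1)] *(4)]] M(3)[OF R(5)[OF *(2,5)] ab(3)]] .
    finally show False using m(4) by simp
  qed
  then have "prime_submod m" using m by (simp add: prime_submod_def)
  then show thesis using that m(2) by blast
qed

text \<open>Denominators come from R even when B is a larger ring. Thus for a fixed prime all these
  localizations contain that of R, which makes them comparable. Only \<open>R - m\<close> enters, so
  \<open>m\<close> may reach outside R.\<close>

definition localized :: "'a set \<Rightarrow> 'a set \<Rightarrow> 'a set" where
  "localized B m = {a / s | a s. a \<in> B \<and> s \<in> R - m}"

lemma subset_localized:
  assumes "prime_submod m"
  shows "B \<subseteq> localized B m"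
proof
  fix b assume "b \<in> B"
  moreover have "1 \<in> R - m" using assms R(2) by (simp add: prime_submod_def)
  ultimately show "b \<in> localized B m" unfolding localized_def by force
qed

lemma localized_mono: "B \<subseteq> C \<Longrightarrow> localized B m \<subseteq> localized C m"
  unfolding localized_def by blast

text \<open>Since f + g = 1 is not in m, one of f and g is an admissible denominator: x = (x f) / f
  in the first case, 1 / x = (g / x) / g in the second.\<close>

lemma total_subring_localized:
  assumes m: "prime_submod m" and B: "unital_subring B" "R \<subseteq> B"
  shows "total_subring (localized B m)"
proof (rule total_subringI)
  note Bs = unital_subringD[OF B(1)]
  have T: "s * t \<in> R - m" if "s \<in> R - m" "t \<in> R - m" for s t
    using that m R(5) by (auto simp: prime_submod_def)
  have T0: "s \<noteq> 0" if "s \<in> R - m" for s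
    using that m by (auto simp: prime_submod_def submod_def)
  show "1 \<in> localized B m" using subset_localized[OF m] Bs(2) by blast
  fix u w assume "u \<in> localized B m" "w \<in> localized B m"
  then obtain a s b t where as: "a \<in> B" "s \<in> R - m" "u = a / s"
    and bt: "b \<in> B" "t \<in> R - m" "w = b / t"
    unfolding localized_def by blast
  have "u + w = (a * t + b * s) / (s * t)"
    using as bt T0 by (simp add: add_frac_eq)
  moreover have "a * t + b * s \<in> B" using as bt Bs(4,5) B(2) by blast
  ultimately show "u + w \<in> localized B m" using T[OF as(2) bt(2)] unfolding localized_def by blast
  have "u * w = (a * b) / (s * t)" using as bt by simp
  then show "u * w \<in> localized B m"
    using T[OF as(2) bt(2)] Bs(5)[OF as(1) bt(1)] unfolding localized_def by blast
next
  fix x :: 'a assume x: "x \<noteq> 0"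
  let ?f = "1 / (1 + p * x\<^sup>2)" and ?g = "p * x\<^sup>2 / (1 + p * x\<^sup>2)"
  have "?f \<notin> m \<or> ?g \<notin> m"
    using pole_sum[of x] m by (metis prime_submod_def submodD(2))
  then show "x \<in> localized B m \<or> inverse x \<in> localized B m"
  proof
    assume "?f \<notin> m"
    moreover have "x = (x / (1 + p * x\<^sup>2)) / ?f" using nz[of x] by simp
    ultimately show ?thesis using pole0 pole1 B(2) unfolding localized_def by blast
  next
    assume g: "?g \<notin> m"
    then have "p \<noteq> 0" using m by (auto simp: prime_submod_def submod_def)
    then have "inverse x = (p * x / (1 + p * x\<^sup>2)) / ?g"
      using x nz[of x] by (simp add: power2_eq_square inverse_eq_divide)
    then show ?thesis using g pole2 B(2) unfolding localized_def by blast
  qed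
qed

end

section \<open>Overrings of valuation rings and elements outside them\<close>

lemma total_subring_overrings_chain:
  assumes "total_subring W" "unital_subring U" "unital_subring V" "W \<subseteq> U" "W \<subseteq> V"
  shows "U \<subseteq> V \<or> V \<subseteq> U"
proof (rule ccontr)
  assume "\<not> ?thesis"
  then obtain a b where ab: "a \<in> U" "a \<notin> V" "b \<in> V" "b \<notin> U" by blast
  then have "a \<noteq> 0" "b \<noteq> 0" using unital_subringD(1) assms(2,3) by auto
  have "a / b \<in> W \<or> b / a \<in> W"
    using assms(1) inverse_divide[of a b] by (metis total_subring_def)
  then show False
  proof
    assume "a / b \<in> W"
    then have "a / b * b \<in> V" using assms(3,5) ab(3) unital_subringD(5) by blast
    then show False using \<open>b \<noteq> 0\<close> ab by simp
  next
    assume "b / a \<in> W"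
    then have "b / a * a \<in> U" using assms(2,4) ab(1) unital_subringD(5) by blast
    then show False using \<open>a \<noteq> 0\<close> ab by simp
  qed
qed

text \<open>Finitely many elements outside V are merged into one that lies in W as soon as one of
  them does. For two elements x and y with q = x / y, the factor \<open>h\<close> has value -min(0,
  v(q)) in each uniformized ring, so \<open>x * h\<close> has value max(v(x), v(y)) there.\<close>

lemma (in pole_ring) ex_common_pole:
  assumes V: "total_subring V" "R \<subseteq> V" and F: "finite F" "F \<noteq> {}" "F \<inter> V = {}"
    and W: "uniformized_subring p W0"
  shows "\<exists>t. t \<notin> V \<and> (\<forall>W. uniformized_subring p W \<longrightarrow> F \<inter> W \<noteq> {} \<longrightarrow> t \<in> W)"
  using F
proof (induction F rule: finite_ne_induct)
  case (singleton x)
  then show ?case by (intro exI[of _ x]) auto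
next
  case (insert x F)
  have sub: "unital_subring V" and tot: "\<And>x. x \<in> V \<or> inverse x \<in> V"
    using V(1) by (auto simp: total_subring_def)
  note Vs = unital_subringD[OF sub]
  obtain y where y: "y \<notin> V"
    and yW: "\<And>W. uniformized_subring p W \<Longrightarrow> F \<inter> W \<noteq> {} \<Longrightarrow> y \<in> W"
    using insert by auto
  have x: "x \<notin> V" using insert.prems by auto
  have nonzero: "x \<noteq> 0" "y \<noteq> 0" using x y Vs(1) by auto
  define q where "q = x / y"
  define h where "h = (1 + p * q\<^sup>2) / (1 + p * q ^ 3)"
  define f where "f = 1 / (1 + p * q\<^sup>2)"
  define g where "g = p * q\<^sup>2 / (1 + p * q\<^sup>2)"
  have fg: "f \<in> V" "g \<in> V" using pole0 pole2 V(2) by (auto simp: f_def g_def)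
  have q0: "q \<noteq> 0" and xq: "x = y * q" using nonzero by (auto simp: q_def)
  \<comment> \<open>The ring \<open>W0\<close> serves to exclude a vanishing denominator of
    \<open>h\<close>.\<close>
  have "1 + p * q ^ 3 \<noteq> 0" using uniformized_subring_min[OF W] by blast
  moreover have "1 + p * q ^ 3 = (1 + p * q\<^sup>2) * (f + g * q)"
    using nz[of q] by (simp add: f_def g_def power2_eq_square power3_eq_cube field_simps)
  ultimately have hfg: "h * (f + g * q) = 1"
    using nz[of q] by (simp add: h_def)
  \<comment> \<open>As h (f + g q) = 1, x is \<open>x * h\<close> times f + g q, and y is
    \<open>x * h\<close> times f / q + g. Since q or 1/q lies in V, \<open>x * h\<close> in V would
    force x or y into V.\<close>
  have "x * h \<notin> V"
  proof
    assume t: "x * h \<in> V"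
    show False
    proof (cases "q \<in> V")
      case True
      have "f + g * q \<in> V" using fg True Vs(4,5) by blast
      then have "(x * h) * (f + g * q) \<in> V" using t Vs(5) by blast
      then show False using x hfg by (simp add: mult.assoc)
    next
      case False
      then have "inverse q \<in> V" using tot by blast
      then have "inverse q * f + g \<in> V" using fg Vs(4,5) by blast
      then have "(x * h) * (inverse q * f + g) \<in> V" using t Vs(5) by blast
      moreover have "(x * h) * (inverse q * f + g) = y * (h * (f + g * q))"
        using q0 by (simp add: xq field_simps)
      ultimately show False using y hfg by simp
    qed
  qed
  moreover have "x * h \<in> W" if W: "uniformized_subring p W" and ne: "insert x F \<inter> W \<noteq> {}" for W
  proof -
    have mult: "\<And>a b. a \<in> W \<Longrightarrow> b \<in> W \<Longrightarrow> a * b \<in> W"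
      using W unital_subringD(5) by (auto simp: uniformized_subring_def)
    have h: "h \<in> W" "q * h \<in> W" using uniformized_subring_min[OF W, of q] by (auto simp: h_def)
    have "x \<in> W \<or> y \<in> W" using ne yW[OF W] by blast
    then show ?thesis
      using mult[OF _ h(1), of x] mult[OF _ h(2), of y] by (auto simp: xq mult.assoc)
  qed
  ultimately show ?case by blast
qed

section \<open>Compact sets of valuations\<close>

lemma S_val_nonempty: "c \<in> S_val \<Longrightarrow> \<exists>v. v \<in> c"
  unfolding S_val_def using in_quotient_imp_non_empty[OF equiv_valuation_equiv] by blast

lemma S_val_krull: "c \<in> S_val \<Longrightarrow> v \<in> c \<Longrightarrow> krull_valuation v"
  by (auto simp: S_val_def quotient_def valuation_equiv_def)

lemma S_val_ring_eq:
  assumes "c \<in> S_val" "v \<in> c" "w \<in> c"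
  shows "valuation_ring v = valuation_ring w"
proof -
  have "(v, w) \<in> valuation_equiv"
    using assms in_quotient_imp_in_rel[OF equiv_valuation_equiv] by (auto simp: S_val_def)
  then show ?thesis
    unfolding valuation_equiv_def using valuation_ring_equivalent by blast
qed

lemma S_val_eq_if_ring_eq:
  assumes "c \<in> S_val" "v \<in> c" "d \<in> S_val" "w \<in> d" "valuation_ring v = valuation_ring w"
  shows "c = d"
proof -
  have "(v, w) \<in> valuation_equiv"
    using equivalent_valuations_if_ring_eq[OF _ _ assms(5)] S_val_krull[OF assms(1,2)]
      S_val_krull[OF assms(3,4)] by (simp add: valuation_equiv_def)
  then show ?thesis
    using assms quotient_eqI[OF equiv_valuation_equiv] unfolding S_val_def by blast
qed

definition rings :: "'a :: field kvaluation set set \<Rightarrow> 'a set set" where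
  "rings S = (\<Union>c\<in>S. valuation_ring ` c)"

text \<open>If no ring of S were contained in V, the open sets \<open>U x\<close> with x outside V
  would cover S. Compactness leaves a finite set F of such x, and \<open>ex_common_pole\<close>
  merges F into one t outside V. This t lies in every ring of S, contradicting that their
  intersection is contained in V.\<close>

lemma compact_coarsening:
  assumes S: "S \<subseteq> S_val" "S \<noteq> {}" "compactin zariski_topology S"
    and p: "\<And>c v. c \<in> S \<Longrightarrow> v \<in> c \<Longrightarrow> uniformizer v p"
    and V: "total_subring V" "\<Inter>(rings S) \<subseteq> V"
  shows "\<exists>c\<in>S. \<exists>v\<in>c. valuation_ring v \<subseteq> V"
proof (rule ccontr)
  assume none: "\<not> ?thesis"
  define U where "U x = {c \<in> S_val. \<forall>v \<in> c. x \<in> valuation_ring v}" for x :: 'a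
  have unif: "uniformized_subring p W" if "W \<in> rings S" for W
    using that p S(1) S_val_krull krull_valuation.uniformized_subring_valuation_ring
    by (fastforce simp: rings_def)
  obtain c0 v0 where c0: "c0 \<in> S" "v0 \<in> c0" using S S_val_nonempty by blast
  then have W0: "valuation_ring v0 \<in> rings S" by (auto simp: rings_def)
  interpret pole_ring p "\<Inter>(rings S)"
    using W0 unif by (intro pole_ring_Inter) auto
  have "S \<subseteq> \<Union>(U ` (- V))"
  proof
    fix c assume c: "c \<in> S"
    then obtain v where v: "v \<in> c" using S S_val_nonempty by blast
    then obtain x where "x \<in> valuation_ring v" "x \<notin> V" using none c by blast
    then show "c \<in> \<Union>(U ` (- V))" using S_val_ring_eq[OF _ v] c v S(1) by (auto simp: U_def)
  qed
  moreover have "openin zariski_topology A" if "A \<in> U ` (- V)" for A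
    using that unfolding zariski_topology_def U_def by (auto intro: topology_generated_by_Basis)
  ultimately obtain \<F> where "finite \<F>" "\<F> \<subseteq> U ` (- V)" "S \<subseteq> \<Union>\<F>"
    using S(3) unfolding compactin_def by meson
  then obtain F where F: "finite F" "F \<subseteq> - V" "S \<subseteq> \<Union>(U ` F)"
    by (metis finite_subset_image)
  then have "F \<noteq> {}" using S(2) by blast
  then obtain t where t: "t \<notin> V"
    and tW: "\<And>W. uniformized_subring p W \<Longrightarrow> F \<inter> W \<noteq> {} \<Longrightarrow> t \<in> W"
    using ex_common_pole[OF V F(1) _ _ unif[OF W0]] F(2) by blast
  have "t \<in> W" if W: "W \<in> rings S" for W
  proof -
    obtain c v where c: "c \<in> S" "v \<in> c" "W = valuation_ring v" using W by (auto simp: rings_def)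
    then obtain x where "x \<in> F" "c \<in> U x" using F(3) by blast
    then show ?thesis using c tW[OF unif[OF W]] by (auto simp: U_def)
  qed
  then show False using t V(2) by blast
qed

section \<open>From local congruences to a simultaneous approximation\<close>

theorem theorem1p6:
  fixes n :: nat
    and x z :: "nat \<Rightarrow> 'a :: field"
    and S :: "nat \<Rightarrow> 'a kvaluation set set"
  assumes z_nonzero: "\<forall>i\<in>{1..n}. z i \<noteq> 0"
    and S_sub: "\<forall>i\<in>{1..n}. S i \<subseteq> S_val"
    and S_disjoint: "disjoint_family_on S {1..n}"
    and U: "\<exists>p. \<forall>c\<in>(\<Union>i\<in>{1..n}. S i). \<forall>v\<in>c. uniformizer v p"
    and T: "\<forall>i\<in>{1..n}. compactin zariski_topology (S i)"
    and I: "\<forall>i\<in>{1..n}. \<forall>j\<in>{1..n}. \<forall>w :: 'a kvaluation.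
              krull_valuation w
              \<and> (\<exists>c\<in>S i. \<exists>v\<in>c. refinement v w)
              \<and> (\<exists>c\<in>S j. \<exists>v\<in>c. refinement v w)
              \<longrightarrow> val_le w (z i) (x i - x j) \<and> val w (z i) = val w (z j)"
  shows "\<exists>y. \<forall>i\<in>{1..n}. \<forall>c\<in>S i. \<forall>v\<in>c. val_less v (z i) (y - x i)"
proof -
  obtain p where p: "\<And>i c v. i \<in> {1..n} \<Longrightarrow> c \<in> S i \<Longrightarrow> v \<in> c \<Longrightarrow> uniformizer v p"
    using U by blast
  \<comment> \<open>For empty S_i the claim is vacuous and there is no coarsening to find, so these
    indices are set aside.\<close>
  define N where "N = {i \<in> {1..n}. S i \<noteq> {}}"
  show ?thesis
  proof (cases "N = {}")
    case True
    then show ?thesis by (auto simp: N_def)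
  next
    case False
    define B where "B i = \<Inter>(rings (S i))" for i
    define F where "F = (\<Union>i\<in>N. rings (S i))"
    define R where "R = \<Inter>F"
    have unif: "uniformized_subring p W" if "W \<in> rings (S i)" "i \<in> N" for i W
    proof -
      obtain c v where c: "c \<in> S i" "v \<in> c" "W = valuation_ring v"
        using \<open>W \<in> _\<close> by (auto simp: rings_def)
      moreover have "krull_valuation v" "uniformizer v p"
        using that(2) c S_sub S_val_krull p unfolding N_def by blast+
      ultimately show ?thesis by (simp add: krull_valuation.uniformized_subring_valuation_ring)
    qed
    have rings_ne: "rings (S i) \<noteq> {}" if i: "i \<in> N" for i
    proof -
      obtain c where "c \<in> S i" "c \<in> S_val" using i S_sub unfolding N_def by blast
      then show ?thesis using S_val_nonempty by (auto simp: rings_def)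
    qed
    obtain W0 where W0: "W0 \<in> F" "uniformized_subring p W0"
      using False rings_ne unif by (fastforce simp: F_def)
    have p0: "p \<noteq> 0" using W0(2) unital_subringD(1) by (auto simp: uniformized_subring_def)
    interpret pole_ring p R
      unfolding R_def using W0 unif by (intro pole_ring_Inter) (auto simp: F_def)
    have B: "unital_subring (B i)" "R \<subseteq> B i" "p \<in> B i" if "i \<in> N" for i
    proof -
      have "pole_ring p (B i)"
        unfolding B_def using that rings_ne unif by (intro pole_ring_Inter) auto
      then show "unital_subring (B i)" "p \<in> B i" by (auto simp: pole_ring_def)
      show "R \<subseteq> B i" using that by (auto simp: R_def B_def F_def)
    qed
    have z: "z i \<noteq> 0" if "i \<in> N" for i using that z_nonzero by (simp add: N_def)
    \<comment> \<open>This is p z_i B_i. By \<open>val_less_if_uniformizer_divides\<close>, y - x_i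
      in A_i implies the required strict inequality at every v in S_i.\<close>
    define A where "A i = {y. y / (p * z i) \<in> B i}" for i
    have A: "submod (A i)" if i: "i \<in> N" for i
    proof -
      note Bi = unital_subringD[OF B(1)[OF i]]
      have "r * (a / (p * z i)) \<in> B i" if "r \<in> R" "a / (p * z i) \<in> B i" for r a
        using that Bi(5) B(2)[OF i] by blast
      then show ?thesis
        unfolding submod_def A_def using Bi by (auto simp: add_divide_distrib)
    qed
    \<comment> \<open>The local congruence at m with denominators cleared. The index of the larger
      localization comes first, so the module of that index alone absorbs the difference.\<close>
    have key: "\<exists>s\<in>R - m. s * (x i - x j) \<in> A i"
      if ij: "i \<in> N" "j \<in> N" "i \<noteq> j" and m: "prime_submod m"
        and sub: "localized (B j) m \<subseteq> localized (B i) m" for i j m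
    proof -
      let ?V = "localized (B i) m"
      have V: "total_subring ?V" by (rule total_subring_localized[OF m B(1,2)[OF ij(1)]])
      then have Vs: "unital_subring ?V" by (simp add: total_subring_def)
      \<comment> \<open>Used for both k = i and k = j with the same V: the valuation of V then has a
        refinement in each of S_i and S_j, as hypothesis (I) demands.\<close>
      have coarse: "\<exists>c\<in>S k. \<exists>v\<in>c. valuation_ring v \<subseteq> ?V" if k: "k \<in> N" "B k \<subseteq> ?V" for k
        using k p T S_sub V by (intro compact_coarsening[of _ p]) (auto simp: N_def B_def)
      obtain c v where c: "c \<in> S i" "v \<in> c" "valuation_ring v \<subseteq> ?V"
        using coarse[OF ij(1) subset_localized[OF m]] by blast
      obtain d u where d: "d \<in> S j" "u \<in> d" "valuation_ring u \<subseteq> ?V"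
        using coarse[OF ij(2)] subset_localized[OF m] sub by blast
      obtain w :: "'a kvaluation" where w: "krull_valuation w" "valuation_ring w = ?V"
        using ex_valuation_of_total_subring[OF V] by blast
      have "val_le w (z i) (x i - x j)"
        using I w ij c d unfolding N_def refinement_def by blast
      then have zd: "(x i - x j) / z i \<in> ?V"
        using krull_valuation.val_le_iff_divide[OF w(1) z[OF ij(1)]] w(2) by simp
      have "inverse p \<in> ?V"
      proof (rule ccontr)
        assume "inverse p \<notin> ?V"
        moreover have "valuation_ring v \<in> rings (S i)" "valuation_ring u \<in> rings (S j)"
          using c d by (auto simp: rings_def)
        ultimately have "?V = valuation_ring v" "?V = valuation_ring u"
          using c(3) d(3) ij uniformized_subring_maximal[OF unif Vs] by blast+
        moreover have "c \<in> S_val" "d \<in> S_val" using c(1) d(1) S_sub ij unfolding N_def by blast+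
        ultimately have "c = d" using c(2) d(2) S_val_eq_if_ring_eq by metis
        then show False
          using c(1) d(1) ij S_disjoint unfolding disjoint_family_on_def N_def by blast
      qed
      then have "(x i - x j) / (p * z i) \<in> ?V"
        using unital_subringD(5)[OF Vs _ zd, of "inverse p"]
        by (simp add: divide_inverse mult.commute mult.left_commute)
      then obtain a s where s: "a \<in> B i" "s \<in> R - m" "(x i - x j) / (p * z i) = a / s"
        unfolding localized_def by blast
      have "s \<noteq> 0" using s(2) m submodD(1) by (auto simp: prime_submod_def)
      then have "s * (x i - x j) / (p * z i) = a" 
        using s(3) by (metis nonzero_mult_div_cancel_left times_divide_eq_right)
      then show ?thesis using s(1,2) by (auto simp: A_def)
    qed
    have "x i - x j \<in> A i + A j" if ij: "i \<in> N" "j \<in> N" for i j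
    proof (rule ccontr)
      let ?d = "x i - x j"
      note Ai = submodD[OF A[OF ij(1)]] and Aj = submodD[OF A[OF ij(2)]]
      assume notin: "?d \<notin> A i + A j"
      have sum: "submod (A i + A j)" by (rule submod_plus[OF A A]) (use ij in auto)
      have "i \<noteq> j" using notin set_plus_intro[OF Ai(1) Aj(1)] by auto
      \<comment> \<open>The ideal of multipliers that carry the difference into A_i + A_j. It is
        proper by assumption, hence contained in some prime m; the contradiction will be an element
        of J outside m.\<close>
      define J where "J = {r \<in> R. r * ?d \<in> A i + A j}"
      have "submod J"
        unfolding submod_def J_def using submodD[OF sum] R
        by (auto simp: distrib_right mult.assoc)
      then obtain m where m: "prime_submod m" "J \<subseteq> m"
        using notin by (elim ex_prime_submod) (auto simp: J_def)
      have loc: "total_subring (localized (B k) m)" "localized R m \<subseteq> localized (B k) m"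
        if "k \<in> N" for k
        using total_subring_localized[OF m(1)] B[OF that] localized_mono by auto
      have "localized (B j) m \<subseteq> localized (B i) m \<or> localized (B i) m \<subseteq> localized (B j) m"
        using loc ij total_subring_localized[OF m(1) subring]
        by (intro total_subring_overrings_chain) (auto simp: total_subring_def)
      then obtain s where s: "s \<in> R - m" "s * ?d \<in> A i + A j"
      proof
        assume "localized (B j) m \<subseteq> localized (B i) m"
        then obtain s where "s \<in> R - m" "s * ?d \<in> A i"
          using key[OF ij \<open>i \<noteq> j\<close> m(1)] by blast
        then show thesis using that set_plus_intro[OF _ Aj(1), of "s * ?d"] by simp
      next
        \<comment> \<open>Here i and j change roles, and the resulting sign is absorbed by
          A_j.\<close>
        assume "localized (B i) m \<subseteq> localized (B j) m"
        then obtain s where s: "s \<in> R - m" "s * (x j - x i) \<in> A j"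
          using key[OF ij(2,1) _ m(1)] \<open>i \<noteq> j\<close> by blast
        have "s * ?d \<in> A j" using Aj(4)[OF s(2)] by (simp add: algebra_simps)
        then show thesis using that s(1) set_plus_intro[OF Ai(1), of "s * ?d"] by simp
      qed
      then show False using m(2) by (auto simp: J_def)
    qed
    moreover have "finite N" by (simp add: N_def)
    ultimately obtain y where y: "\<And>i. i \<in> N \<Longrightarrow> y - x i \<in> A i"
      using chinese_remainder[of N A x] A by blast
    have "val_less v (z i) (y - x i)" if "i \<in> {1..n}" "c \<in> S i" "v \<in> c" for i c v
    proof (rule krull_valuation.val_less_if_uniformizer_divides)
      have i: "i \<in> N" using that by (auto simp: N_def)
      show "krull_valuation v" using that S_sub S_val_krull by blast
      show "uniformizer v p" using that p by blast
      show "z i \<noteq> 0" using z i by blast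
      show "(y - x i) / (p * z i) \<in> valuation_ring v"
        using y[OF i] that unfolding A_def B_def rings_def by blast
    qed
    then show ?thesis by blast
  qed
qed

end
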